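(* Let $R=\mathbb F_{q_1}\times\cdots\times\mathbb F_{q_t}$ be a product of $t\ge 3$ finite fields of orders $q_1,\dots,q_t$. Let $A$ be a nonempty proper subset of $[t]$ and let $v\in X_A$. Then $$\deg_{\mathcal D(R)}(v)=\begin{cases}|Z(R)^*|-P(A), & 1\le|A|\le t-2,\\ |Z(R)^*|-P(A)-w(A)+1, & |A|=t-1,\end{cases}$$ where $P(A)=\prod_{i\in[t]\setminus A}q_i$ and $w(A)=\prod_{i\in A}(q_i-1)$.
   Context: $[t]=\{1,\dots,t\}$. $Z(R)$ is the set of zero-divisors of $R$ and $Z(R)^*=Z(R)\setminus\{0\}$. For $x=(x_1,\dots,x_t)\in R$, $\operatorname{supp}(x)=\{i\in[t]:x_i\ne0\}$, and $X_A=\{x\in Z(R)^*:\operatorname{supp}(x)=A\}$. $\Gamma(R)$ is the simple graph with vertex set $Z(R)^*$, with distinct $x,y$ adjacent iff $xy=0$. $W\Gamma(R)$ is the simple graph with vertex set $Z(R)^*$, with distinct $x,y$ adjacent iff there exist nonzero $r\in\operatorname{Ann}(x)$ and nonzero $s\in\operatorname{Ann}(y)$ with $rs=0$. The weak zero-divisor difference graph $\mathcal D(R)$ is the graph on $Z(R)^*$ with edge set $E(W\Gamma(R))\setminus E(\Gamma(R))$, with resulting isolated vertices deleted (for $t\ge3$ no vertex is in fact isolated, so the vertex set is $Z(R)^*$). *)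

theory Defs
  imports "HOL-Algebra.Chinese_Remainder" "Graph_Theory.Pair_Digraph"
begin

section \<open>Zero-divisors and annihilators\<close>

text \<open>The ring \<open>R\<close> is meant to be commutative. In a nonzero ring, \<open>\<zero>\<close> counts as a zero-divisor.\<close>

definition zero_divisors :: "('a, 'm) ring_scheme \<Rightarrow> 'a set" where
  "zero_divisors R =
     {x \<in> carrier R. \<exists>y \<in> carrier R. y \<noteq> \<zero>\<^bsub>R\<^esub> \<and> x \<otimes>\<^bsub>R\<^esub> y = \<zero>\<^bsub>R\<^esub>}"

definition nonzero_zero_divisors :: "('a, 'm) ring_scheme \<Rightarrow> 'a set" where
  "nonzero_zero_divisors R = zero_divisors R - {\<zero>\<^bsub>R\<^esub>}"

definition annihilator :: "('a, 'm) ring_scheme \<Rightarrow> 'a \<Rightarrow> 'a set" where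
  "annihilator R x = {r \<in> carrier R. r \<otimes>\<^bsub>R\<^esub> x = \<zero>\<^bsub>R\<^esub>}"

section \<open>The graphs\<close>

text \<open>
  A simple graph is a loop-free symmetric digraph without parallel arcs (locale \<^locale>\<open>pair_graph\<close>):
  the edge \<open>{x, y}\<close> is the pair of arcs \<open>(x, y)\<close>, \<open>(y, x)\<close>. The degree of a vertex is therefore
  its \<^const>\<open>out_degree\<close>.
\<close>

definition zero_divisor_graph :: "('a, 'm) ring_scheme \<Rightarrow> 'a pair_pre_digraph" where
  "zero_divisor_graph R =
     \<lparr> pverts = nonzero_zero_divisors R,
       parcs = {(x, y). x \<in> nonzero_zero_divisors R \<and> y \<in> nonzero_zero_divisors R \<and> x \<noteq> y \<and>
                  x \<otimes>\<^bsub>R\<^esub> y = \<zero>\<^bsub>R\<^esub>} \<rparr>"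

definition weak_zero_divisor_graph :: "('a, 'm) ring_scheme \<Rightarrow> 'a pair_pre_digraph" where
  "weak_zero_divisor_graph R =
     \<lparr> pverts = nonzero_zero_divisors R,
       parcs = {(x, y). x \<in> nonzero_zero_divisors R \<and> y \<in> nonzero_zero_divisors R \<and> x \<noteq> y \<and>
                  (\<exists>r \<in> annihilator R x. \<exists>s \<in> annihilator R y.
                     r \<noteq> \<zero>\<^bsub>R\<^esub> \<and> s \<noteq> \<zero>\<^bsub>R\<^esub> \<and> r \<otimes>\<^bsub>R\<^esub> s = \<zero>\<^bsub>R\<^esub>)} \<rparr>"

definition delete_isolated :: "'a pair_pre_digraph \<Rightarrow> 'a pair_pre_digraph" where
  "delete_isolated G =
     \<lparr> pverts = {x \<in> pverts G. \<exists>e \<in> parcs G. x = fst e \<or> x = snd e}, parcs = parcs G \<rparr>"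

definition weak_zero_divisor_difference_graph ::
    "('a, 'm) ring_scheme \<Rightarrow> 'a pair_pre_digraph" where
  "weak_zero_divisor_difference_graph R =
     delete_isolated
       \<lparr> pverts = nonzero_zero_divisors R,
         parcs = parcs (weak_zero_divisor_graph R) - parcs (zero_divisor_graph R) \<rparr>"

lemma pair_graph_weak_zero_divisor_difference_graph:
  assumes "cring R" and "finite (carrier R)"
  shows "pair_graph (weak_zero_divisor_difference_graph R)"
proof -
  interpret cring R by fact
  let ?G = "weak_zero_divisor_difference_graph R"
  have sub: "nonzero_zero_divisors R \<subseteq> carrier R"
    by (auto simp: nonzero_zero_divisors_def zero_divisors_def)
  then have fin: "finite (nonzero_zero_divisors R)"
    using assms(2) by (rule finite_subset)
  have arcs: "parcs ?G \<subseteq> nonzero_zero_divisors R \<times> nonzero_zero_divisors R"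
    by (auto simp: weak_zero_divisor_difference_graph_def delete_isolated_def
        weak_zero_divisor_graph_def)
  have "sym (parcs ?G)"
  proof (rule symI)
    fix x y assume xy: "(x, y) \<in> parcs ?G"
    then have "x \<in> carrier R" "y \<in> carrier R" using arcs sub by auto
    then have "x \<otimes>\<^bsub>R\<^esub> y = y \<otimes>\<^bsub>R\<^esub> x" by (rule m_comm)
    moreover obtain r s where rs: "r \<in> annihilator R x" "s \<in> annihilator R y"
      "r \<noteq> \<zero>\<^bsub>R\<^esub>" "s \<noteq> \<zero>\<^bsub>R\<^esub>" "r \<otimes>\<^bsub>R\<^esub> s = \<zero>\<^bsub>R\<^esub>"
      using xy by (auto simp: weak_zero_divisor_difference_graph_def delete_isolated_def
          weak_zero_divisor_graph_def)
    moreover have "s \<otimes>\<^bsub>R\<^esub> r = \<zero>\<^bsub>R\<^esub>"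
      using rs m_comm[of s r] by (auto simp: annihilator_def)
    ultimately show "(y, x) \<in> parcs ?G"
      using xy by (auto simp: weak_zero_divisor_difference_graph_def delete_isolated_def
          weak_zero_divisor_graph_def zero_divisor_graph_def)
  qed
  moreover have "finite (parcs ?G)"
    using arcs fin by (meson finite_SigmaI finite_subset)
  moreover have "fst e \<noteq> snd e" if "e \<in> parcs ?G" for e
    using that by (auto simp: weak_zero_divisor_difference_graph_def delete_isolated_def
        weak_zero_divisor_graph_def)
  moreover have "finite (pverts ?G)"
    using fin by (simp add: weak_zero_divisor_difference_graph_def delete_isolated_def)
  moreover have "fst e \<in> pverts ?G \<and> snd e \<in> pverts ?G" if "e \<in> parcs ?G" for e
    using that arcs
    by (fastforce simp: weak_zero_divisor_difference_graph_def delete_isolated_def)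
  ultimately show ?thesis
    by unfold_locales (auto simp: symmetric_def)
qed

section \<open>Supports in a finite product of rings\<close>

text \<open>
  Elements of \<^term>\<open>RDirProd_list Rs\<close> are lists, so the factors, and hence supports, are indexed by
  \<open>{..<length Rs}\<close> instead of \<open>{1..t}\<close>. The library defines the multiplication of this ring
  through inverse images; the following lemma confirms that it is the componentwise one.
\<close>

lemma RDirProd_list_mult:
  assumes "x \<in> carrier (RDirProd_list Rs)" and "y \<in> carrier (RDirProd_list Rs)"
    and "i < length Rs"
  shows "(x \<otimes>\<^bsub>RDirProd_list Rs\<^esub> y) ! i = x ! i \<otimes>\<^bsub>Rs ! i\<^esub> y ! i"
  using assms
proof (induction Rs arbitrary: x y i)
  case Nil
  then show ?case by simp
next
  case (Cons R Rs)
  obtain a xs where x: "x = a # xs" "a \<in> carrier R" "xs \<in> carrier (RDirProd_list Rs)"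
    using Cons.prems(1) unfolding RDirProd_list_carrier by auto
  obtain b ys where y: "y = b # ys" "b \<in> carrier R" "ys \<in> carrier (RDirProd_list Rs)"
    using Cons.prems(2) unfolding RDirProd_list_carrier by auto
  have "x \<otimes>\<^bsub>RDirProd_list (R # Rs)\<^esub> y
      = (\<lambda>(a, as). a # as) ((a, xs) \<otimes>\<^bsub>RDirProd R (RDirProd_list Rs)\<^esub> (b, ys))"
    using ring_hom_mult[OF RDirProd_list_hom1, of "(a, xs)" R Rs "(b, ys)"] x y
    by (simp add: RDirProd_carrier)
  also have "\<dots> = (a \<otimes>\<^bsub>R\<^esub> b) # (xs \<otimes>\<^bsub>RDirProd_list Rs\<^esub> ys)"
    by (simp add: RDirProd_def DirProd_def monoid.defs)
  finally show ?case
    using Cons.IH[OF x(3) y(3)] Cons.prems(3) x(1) y(1) by (cases i) auto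
qed

definition supp :: "('a, 'm) ring_scheme list \<Rightarrow> 'a list \<Rightarrow> nat set" where
  "supp Rs x = {i. i < length Rs \<and> x ! i \<noteq> \<zero>\<^bsub>Rs ! i\<^esub>}"

definition support_class :: "('a, 'm) ring_scheme list \<Rightarrow> nat set \<Rightarrow> 'a list set" where
  "support_class Rs A = {x \<in> nonzero_zero_divisors (RDirProd_list Rs). supp Rs x = A}"

end

theory Submission
  imports Defs
begin

text \<open>
  In a product of fields, \<open>supp (x y) = supp x \<inter> supp y\<close>, so both graphs depend on supports only.
  Distinct vertices with supports \<open>A\<close> and \<open>B\<close> are adjacent in the zero-divisor graph iff
  \<open>A \<inter> B = {}\<close>. They are adjacent in the weak graph iff disjoint nonempty sets can be chosen
  inside the complements of \<open>A\<close> and \<open>B\<close>, which fails only if both complements are the same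
  singleton. The non-neighbours of \<open>v\<close> in the difference graph are therefore \<open>v\<close> itself, the
  \<open>P(A) - 1\<close> nonzero elements of its annihilator and, if \<open>card A = t - 1\<close>, the whole class of \<open>v\<close>.
\<close>

text \<open>Evaluation at the positions \<open>0..<n\<close> is a bijection onto the lists from the
  dependent functions counted by \<open>card_PiE\<close>. Every set of ring elements counted below
  is a box of this kind.\<close>

lemma card_lists_nth_in:
  "card {xs. length xs = n \<and> (\<forall>i<n. xs ! i \<in> B i)} = (\<Prod>i<n. card (B i))"
proof -
  let ?S = "{xs. length xs = n \<and> (\<forall>i<n. xs ! i \<in> B i)}"
  have "bij_betw (\<lambda>f. map f [0..<n]) (PiE {..<n} B) ?S"
  proof (rule bij_betw_byWitness[where f' = "\<lambda>xs. \<lambda>i\<in>{..<n}. xs ! i"])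
    show "\<forall>f \<in> PiE {..<n} B. (\<lambda>i\<in>{..<n}. map f [0..<n] ! i) = f"
      by (auto simp: fun_eq_iff restrict_def PiE_def extensional_def)
    show "\<forall>xs \<in> ?S. map (\<lambda>i\<in>{..<n}. xs ! i) [0..<n] = xs"
      by (simp add: list_eq_iff_nth_eq)
    show "(\<lambda>f. map f [0..<n]) ` PiE {..<n} B \<subseteq> ?S"
      by (rule image_subsetI) (simp add: PiE_iff)
    show "(\<lambda>xs. \<lambda>i\<in>{..<n}. xs ! i) ` ?S \<subseteq> PiE {..<n} B"
      by (intro image_subsetI PiE_I) simp_all
  qed
  then have "card (PiE {..<n} B) = card ?S"
    by (rule bij_betw_same_card)
  then show ?thesis
    by (simp add: card_PiE)
qed

section \<open>Carrier, zero and supports in the product ring\<close>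

lemma RDirProd_list_zero_nth:
  "length \<zero>\<^bsub>RDirProd_list Rs\<^esub> = length Rs"
  "i < length Rs \<Longrightarrow> \<zero>\<^bsub>RDirProd_list Rs\<^esub> ! i = \<zero>\<^bsub>Rs ! i\<^esub>"
proof -
  show "length \<zero>\<^bsub>RDirProd_list Rs\<^esub> = length Rs"
    unfolding RDirProd_list_zero by (induction Rs) simp_all
  show "i < length Rs \<Longrightarrow> \<zero>\<^bsub>RDirProd_list Rs\<^esub> ! i = \<zero>\<^bsub>Rs ! i\<^esub>"
    unfolding RDirProd_list_zero by (induction Rs arbitrary: i) (auto simp: less_Suc_eq_0_disj)
qed

lemma carrier_RDirProd_list:
  "carrier (RDirProd_list Rs)
     = {x. length x = length Rs \<and> (\<forall>i<length Rs. x ! i \<in> carrier (Rs ! i))}"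
  by (auto dest: RDirProd_list_carrier_mem intro: RDirProd_list_carrier_memI)

lemma supp_subset: "supp Rs x \<subseteq> {..<length Rs}"
  by (auto simp: supp_def)

lemma supp_zero: "supp Rs \<zero>\<^bsub>RDirProd_list Rs\<^esub> = {}"
  by (simp add: supp_def RDirProd_list_zero_nth)

lemma eq_zero_iff_supp:
  assumes "x \<in> carrier (RDirProd_list Rs)"
  shows "x = \<zero>\<^bsub>RDirProd_list Rs\<^esub> \<longleftrightarrow> supp Rs x = {}"
  using assms by (auto simp: supp_def RDirProd_list_zero_nth carrier_RDirProd_list
      intro!: nth_equalityI)

text \<open>Singletons suffice as \<open>S\<close> and \<open>T\<close>, so the question is whether
  \<open>C\<close> and \<open>D\<close> contain two distinct elements, one each. For nonempty sets
  this fails only when both are the same singleton.\<close>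

lemma two_elem_disjoint_choice:
  "(\<exists>S T. S \<subseteq> C \<and> T \<subseteq> D \<and> S \<noteq> {} \<and> T \<noteq> {} \<and> S \<inter> T = {})
     \<longleftrightarrow> C \<noteq> {} \<and> D \<noteq> {} \<and> \<not> (\<exists>i. C = {i} \<and> D = {i})"
  (is "?L \<longleftrightarrow> ?R")
proof
  assume ?R
  then obtain a b where ab: "a \<in> C" "b \<in> D" "\<not> (C = {a} \<and> D = {a})"
    by blast
  obtain c d where "c \<in> C" "d \<in> D" "c \<noteq> d"
  proof (cases "a = b")
    case True
    \<comment> \<open>The sets are not both \<open>{a}\<close>, so one of them has a further
      element, which is paired with \<open>a\<close> from the other set.\<close>
    then have "(\<exists>c\<in>C. c \<noteq> a) \<or> (\<exists>d\<in>D. d \<noteq> a)"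
      using ab by auto
    then show ?thesis
      using True ab that by metis
  qed (use ab that in blast)
  then show ?L
    by (intro exI[of _ "{c}"] exI[of _ "{d}"]) auto
qed blast

section \<open>Products of fields: from ring equations to supports\<close>

locale field_list =
  fixes Fs :: "('a, 'm) ring_scheme list"
  assumes fields: "i < length Fs \<Longrightarrow> field (Fs ! i)"
begin

abbreviation "P \<equiv> RDirProd_list Fs"

lemma domains: "i < length Fs \<Longrightarrow> domain (Fs ! i)"
  using fields by (simp add: field_def)

lemma rings: "i < length Fs \<Longrightarrow> ring (Fs ! i)"
  using domains by (simp add: domain_def cring_def)

lemma zero_closed_nth: "i < length Fs \<Longrightarrow> \<zero>\<^bsub>Fs ! i\<^esub> \<in> carrier (Fs ! i)"
  by (simp add: rings ring.ring_simprules)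

sublocale ring P
  by (rule RDirProd_list_is_ring) (rule rings)

text \<open>Each factor is an integral domain, so a coordinate of the product is nonzero exactly
  when both coordinates are.\<close>

lemma supp_mult:
  assumes "x \<in> carrier P" "y \<in> carrier P"
  shows "supp Fs (x \<otimes>\<^bsub>P\<^esub> y) = supp Fs x \<inter> supp Fs y"
  using assms domain.integral_iff[OF domains]
  by (auto simp: supp_def RDirProd_list_mult carrier_RDirProd_list zero_closed_nth)

lemma mult_eq_zero_iff_supp:
  assumes "x \<in> carrier P" "y \<in> carrier P"
  shows "x \<otimes>\<^bsub>P\<^esub> y = \<zero>\<^bsub>P\<^esub> \<longleftrightarrow> supp Fs x \<inter> supp Fs y = {}"
  using assms by (simp add: eq_zero_iff_supp supp_mult)

text \<open>The idempotent with ones on \<open>S\<close> has this support. Hence quantifying over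
  ring elements by support is the same as quantifying over subsets of the index set.\<close>

lemma exists_supp_eq:
  assumes "S \<subseteq> {..<length Fs}"
  obtains x where "x \<in> carrier P" "supp Fs x = S"
proof
  let ?x = "map (\<lambda>i. if i \<in> S then \<one>\<^bsub>Fs ! i\<^esub> else \<zero>\<^bsub>Fs ! i\<^esub>) [0..<length Fs]"
  show "?x \<in> carrier P"
    using rings by (auto simp: carrier_RDirProd_list ring.ring_simprules)
  show "supp Fs ?x = S"
    using assms domain.one_not_zero[OF domains] by (auto simp: supp_def split: if_splits)
qed

lemma nonzero_zero_divisors_eq:
  "nonzero_zero_divisors P
     = {x \<in> carrier P. supp Fs x \<noteq> {} \<and> supp Fs x \<noteq> {..<length Fs}}"
proof -
  have "(\<exists>y \<in> carrier P. y \<noteq> \<zero>\<^bsub>P\<^esub> \<and> x \<otimes>\<^bsub>P\<^esub> y = \<zero>\<^bsub>P\<^esub>) \<longleftrightarrow> supp Fs x \<noteq> {..<length Fs}"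
    (is "?L \<longleftrightarrow> ?R") if x: "x \<in> carrier P" for x
  proof
    assume ?L
    then show ?R
      using x supp_subset[of Fs] by (auto simp: eq_zero_iff_supp supp_mult)
  next
    assume ?R
    \<comment> \<open>An element supported on the complement of \<open>supp Fs x\<close> kills
      \<open>x\<close>, and it is nonzero because that complement is nonempty.\<close>
    moreover obtain y where "y \<in> carrier P" "supp Fs y = {..<length Fs} - supp Fs x"
      using exists_supp_eq by (metis Diff_subset)
    ultimately show ?L
      using x supp_subset[of Fs x]
      by (intro bexI[of _ y]) (auto simp: eq_zero_iff_supp supp_mult)
  qed
  then have "zero_divisors P = {x \<in> carrier P. supp Fs x \<noteq> {..<length Fs}}"
    unfolding zero_divisors_def by blast
  then show ?thesis
    by (auto simp: nonzero_zero_divisors_def eq_zero_iff_supp supp_zero)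
qed

text \<open>Annihilators consist of the elements supported in the complement, so
  \<open>two_elem_disjoint_choice\<close> applies to the complements of the two supports. The case
  \<open>x = y\<close> is included. Writing \<open>Suc\<close> avoids truncated subtraction.\<close>

lemma weak_adjacent_iff:
  assumes x: "x \<in> nonzero_zero_divisors P" and y: "y \<in> nonzero_zero_divisors P"
  shows "(\<exists>r \<in> annihilator P x. \<exists>s \<in> annihilator P y.
            r \<noteq> \<zero>\<^bsub>P\<^esub> \<and> s \<noteq> \<zero>\<^bsub>P\<^esub> \<and> r \<otimes>\<^bsub>P\<^esub> s = \<zero>\<^bsub>P\<^esub>)
         \<longleftrightarrow> \<not> (supp Fs x = supp Fs y \<and> Suc (card (supp Fs x)) = length Fs)"
    (is "?L \<longleftrightarrow> \<not> ?E")
proof -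
  let ?C = "{..<length Fs} - supp Fs x" and ?D = "{..<length Fs} - supp Fs y"
  have carr: "x \<in> carrier P" "y \<in> carrier P"
    using x y by (auto simp: nonzero_zero_divisors_eq)
  have ann: "r \<in> annihilator P z \<longleftrightarrow> r \<in> carrier P \<and> supp Fs r \<subseteq> {..<length Fs} - supp Fs z"
    if "z \<in> carrier P" for r z
    using that supp_subset[of Fs r] by (auto simp: annihilator_def mult_eq_zero_iff_supp)
  have "?L \<longleftrightarrow> (\<exists>S T. S \<subseteq> ?C \<and> T \<subseteq> ?D \<and> S \<noteq> {} \<and> T \<noteq> {} \<and> S \<inter> T = {})" (is "_ \<longleftrightarrow> ?M")
  proof
    assume ?L
    then obtain r s where "r \<in> annihilator P x" "s \<in> annihilator P y"
      "r \<noteq> \<zero>\<^bsub>P\<^esub>" "s \<noteq> \<zero>\<^bsub>P\<^esub>" "r \<otimes>\<^bsub>P\<^esub> s = \<zero>\<^bsub>P\<^esub>"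
      by blast
    then show ?M
      using carr by (intro exI[of _ "supp Fs r"] exI[of _ "supp Fs s"])
        (auto simp: ann eq_zero_iff_supp supp_mult)
  next
    assume ?M
    then obtain S T where ST: "S \<subseteq> ?C" "T \<subseteq> ?D" "S \<noteq> {}" "T \<noteq> {}" "S \<inter> T = {}"
      by blast
    obtain r where "r \<in> carrier P" "supp Fs r = S"
      using exists_supp_eq[of S] ST by blast
    moreover obtain s where "s \<in> carrier P" "supp Fs s = T"
      using exists_supp_eq[of T] ST by blast
    ultimately show ?L
      using carr ST by (intro bexI[of _ r] bexI[of _ s])
        (simp_all add: ann eq_zero_iff_supp supp_mult)
  qed
  also have "\<dots> \<longleftrightarrow> ?C \<noteq> {} \<and> ?D \<noteq> {} \<and> \<not> (\<exists>i. ?C = {i} \<and> ?D = {i})"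
    by (rule two_elem_disjoint_choice)
  \<comment> \<open>Both complements are nonempty because \<open>x\<close> and \<open>y\<close> are
    zero-divisors.\<close>
  also have "\<dots> \<longleftrightarrow> \<not> (\<exists>i. ?C = {i} \<and> ?D = {i})"
    using x y supp_subset[of Fs x] supp_subset[of Fs y] by (auto simp: nonzero_zero_divisors_eq)
  also have "(\<exists>i. ?C = {i} \<and> ?D = {i}) \<longleftrightarrow> ?C = ?D \<and> card ?C = 1"
    by (auto simp: card_1_singleton_iff)
  also have "?C = ?D \<longleftrightarrow> supp Fs x = supp Fs y"
    using supp_subset[of Fs x] supp_subset[of Fs y] by blast
  also have "card ?C = 1 \<longleftrightarrow> Suc (card (supp Fs x)) = length Fs"
    using supp_subset[of Fs x] card_mono[OF _ supp_subset[of Fs x]]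
    by (auto simp: card_Diff_subset finite_subset)
  finally show ?thesis .
qed

text \<open>The removed set is the union of the neighbours of \<open>v\<close> in the zero-divisor
  graph and the vertices not weakly adjacent to \<open>v\<close>. In the case
  \<open>Suc (card A) = length Fs\<close>, the support class already contains \<open>v\<close>.
  Deleting isolated vertices leaves the arcs unchanged.\<close>

lemma out_arcs_difference_graph:
  assumes v: "v \<in> support_class Fs A"
  shows "out_arcs (with_proj (weak_zero_divisor_difference_graph P)) v
     = Pair v ` (nonzero_zero_divisors P
         - ({x \<in> carrier P. x \<noteq> \<zero>\<^bsub>P\<^esub> \<and> supp Fs x \<inter> A = {}}
            \<union> (if Suc (card A) = length Fs then support_class Fs A else {v})))"
proof -
  have vP: "v \<in> nonzero_zero_divisors P" "v \<in> carrier P" and A: "supp Fs v = A" "A \<noteq> {}"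
    using v by (auto simp: support_class_def nonzero_zero_divisors_eq)
  have arc: "(v, x) \<in> parcs (weak_zero_divisor_difference_graph P) \<longleftrightarrow>
      x \<noteq> v \<and> supp Fs x \<inter> A \<noteq> {} \<and> \<not> (supp Fs x = A \<and> Suc (card A) = length Fs)"
    if x: "x \<in> nonzero_zero_divisors P" for x
  proof -
    have "x \<in> carrier P"
      using x by (simp add: nonzero_zero_divisors_eq)
    then have "v \<otimes>\<^bsub>P\<^esub> x \<noteq> \<zero>\<^bsub>P\<^esub> \<longleftrightarrow> supp Fs x \<inter> A \<noteq> {}"
      using vP A by (simp add: mult_eq_zero_iff_supp Int_commute)
    then show ?thesis
      using x vP weak_adjacent_iff[OF vP(1) x, unfolded A(1)]
      by (auto simp: weak_zero_divisor_difference_graph_def delete_isolated_def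
          weak_zero_divisor_graph_def zero_divisor_graph_def)
  qed
  moreover have "x \<in> nonzero_zero_divisors P"
    if "(v, x) \<in> parcs (weak_zero_divisor_difference_graph P)" for x
    using that by (auto simp: weak_zero_divisor_difference_graph_def delete_isolated_def
        weak_zero_divisor_graph_def)
  ultimately have "{x. (v, x) \<in> parcs (weak_zero_divisor_difference_graph P)}
      = {x \<in> nonzero_zero_divisors P. x \<noteq> v \<and> supp Fs x \<inter> A \<noteq> {} \<and>
            \<not> (supp Fs x = A \<and> Suc (card A) = length Fs)}"
    by blast
  also have "{x \<in> nonzero_zero_divisors P. x \<noteq> v \<and> supp Fs x \<inter> A \<noteq> {} \<and>
            \<not> (supp Fs x = A \<and> Suc (card A) = length Fs)}
      = nonzero_zero_divisors P
         - ({x \<in> carrier P. x \<noteq> \<zero>\<^bsub>P\<^esub> \<and> supp Fs x \<inter> A = {}}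
            \<union> (if Suc (card A) = length Fs then support_class Fs A else {v}))"
    using v by (auto simp: support_class_def nonzero_zero_divisors_eq eq_zero_iff_supp supp_zero)
  finally have arcs: "{x. (v, x) \<in> parcs (weak_zero_divisor_difference_graph P)} = \<dots>" .
  have "out_arcs (with_proj (weak_zero_divisor_difference_graph P)) v
      = Pair v ` {x. (v, x) \<in> parcs (weak_zero_divisor_difference_graph P)}"
    by (auto simp: out_arcs_def)
  then show ?thesis
    unfolding arcs .
qed

section \<open>Counting elements by support: the numbers P(A) and w(A)\<close>

lemma card_supp_disjoint:
  assumes "A \<subseteq> {..<length Fs}"
  shows "card {x \<in> carrier P. supp Fs x \<inter> A = {}} = (\<Prod>i\<in>{..<length Fs} - A. order (Fs ! i))"
proof -
  let ?B = "\<lambda>i. if i \<in> A then {\<zero>\<^bsub>Fs ! i\<^esub>} else carrier (Fs ! i)"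
  have "supp Fs x \<inter> A = {} \<longleftrightarrow> (\<forall>i<length Fs. i \<in> A \<longrightarrow> x ! i = \<zero>\<^bsub>Fs ! i\<^esub>)" for x
    by (auto simp: supp_def)
  then have "{x \<in> carrier P. supp Fs x \<inter> A = {}}
      = {x. length x = length Fs \<and> (\<forall>i<length Fs. x ! i \<in> ?B i)}"
    by (auto simp: carrier_RDirProd_list zero_closed_nth split: if_splits)
  then have "card {x \<in> carrier P. supp Fs x \<inter> A = {}} = (\<Prod>i<length Fs. card (?B i))"
    by (simp only: card_lists_nth_in)
  \<comment> \<open>Coordinates in \<open>A\<close> are forced to be zero and contribute the factor
    1.\<close>
  also have "\<dots> = (\<Prod>i\<in>{..<length Fs} - A. order (Fs ! i))"
    by (rule prod.mono_neutral_cong_right) (auto simp: order_def)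
  finally show ?thesis .
qed

lemma card_supp_eq:
  assumes "A \<subseteq> {..<length Fs}"
  shows "card {x \<in> carrier P. supp Fs x = A} = (\<Prod>i\<in>A. order (Fs ! i) - 1)"
proof -
  let ?B = "\<lambda>i. if i \<in> A then carrier (Fs ! i) - {\<zero>\<^bsub>Fs ! i\<^esub>} else {\<zero>\<^bsub>Fs ! i\<^esub>}"
  have "supp Fs x = A \<longleftrightarrow> (\<forall>i<length Fs. i \<in> A \<longleftrightarrow> x ! i \<noteq> \<zero>\<^bsub>Fs ! i\<^esub>)" for x
    using assms unfolding supp_def by blast
  moreover have "y \<in> ?B i \<longleftrightarrow> y \<in> carrier (Fs ! i) \<and> (i \<in> A \<longleftrightarrow> y \<noteq> \<zero>\<^bsub>Fs ! i\<^esub>)"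
    if "i < length Fs" for i y
    using zero_closed_nth[OF that] by auto
  ultimately have "{x \<in> carrier P. supp Fs x = A}
      = {x. length x = length Fs \<and> (\<forall>i<length Fs. x ! i \<in> ?B i)}"
    unfolding carrier_RDirProd_list by blast
  then have "card {x \<in> carrier P. supp Fs x = A} = (\<Prod>i<length Fs. card (?B i))"
    by (simp only: card_lists_nth_in)
  also have "\<dots> = (\<Prod>i\<in>A. order (Fs ! i) - 1)"
    using assms
    by (intro prod.mono_neutral_cong_right)
      (auto simp: order_def card_Diff_singleton zero_closed_nth)
  finally show ?thesis .
qed

text \<open>Both cases of the theorem at once: the final \<open>+ 1\<close> accounts for zero, which
  is counted in P(A) but is not a vertex. In the \<open>else\<close> branch it cancels against the 1
  for \<open>v\<close> itself.\<close>

lemma out_degree_difference_graph: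
  assumes fin: "\<And>i. i < length Fs \<Longrightarrow> finite (carrier (Fs ! i))"
    and v: "v \<in> support_class Fs A"
  shows "int (out_degree (with_proj (weak_zero_divisor_difference_graph P)) v)
     = int (card (nonzero_zero_divisors P)) - (\<Prod>i\<in>{..<length Fs} - A. int (order (Fs ! i)))
       - (if Suc (card A) = length Fs then \<Prod>i\<in>A. int (order (Fs ! i)) - 1 else 1) + 1"
proof -
  let ?Z = "nonzero_zero_divisors P"
  let ?N = "{x \<in> carrier P. supp Fs x \<inter> A = {}}"
  let ?W = "if Suc (card A) = length Fs then support_class Fs A else {v}"
  have vP: "v \<in> ?Z" and A: "supp Fs v = A" "A \<noteq> {}" "A \<noteq> {..<length Fs}"
    using v by (auto simp: support_class_def nonzero_zero_divisors_eq)
  have sub: "A \<subseteq> {..<length Fs}"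
    using A supp_subset by metis
  \<comment> \<open>Finiteness of the ring: its elements are lists of fixed length over a finite
    union of finite carriers.\<close>
  have "carrier P \<subseteq> {x. set x \<subseteq> (\<Union>i<length Fs. carrier (Fs ! i)) \<and> length x = length Fs}"
    by (fastforce simp: carrier_RDirProd_list in_set_conv_nth)
  then have finP: "finite (carrier P)"
    by (rule finite_subset) (simp add: finite_lists_length_eq fin)
  then have finZ: "finite ?Z"
    by (simp add: nonzero_zero_divisors_eq)
  have zero: "\<zero>\<^bsub>P\<^esub> \<in> ?N"
    by (simp add: supp_zero)
  have N: "{x \<in> carrier P. x \<noteq> \<zero>\<^bsub>P\<^esub> \<and> supp Fs x \<inter> A = {}} = ?N - {\<zero>\<^bsub>P\<^esub>}"
    by blast
  \<comment> \<open>The support of an element of \<open>?N\<close> misses the nonempty set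
    \<open>A\<close>, so it is not full. Elements of \<open>?W\<close> have support
    \<open>A\<close>, which makes the two sets disjoint.\<close>
  have NZ: "?N - {\<zero>\<^bsub>P\<^esub>} \<subseteq> ?Z" "?W \<subseteq> ?Z" "(?N - {\<zero>\<^bsub>P\<^esub>}) \<inter> ?W = {}"
    using vP sub A by (auto simp: nonzero_zero_divisors_eq eq_zero_iff_supp support_class_def)
  have fins: "finite (?N - {\<zero>\<^bsub>P\<^esub>})" "finite ?W"
    by (rule finite_subset[OF NZ(1) finZ], rule finite_subset[OF NZ(2) finZ])
  have cardN: "int (card ?N) = (\<Prod>i\<in>{..<length Fs} - A. int (order (Fs ! i)))"
    using card_supp_disjoint[OF sub] by simp
  have "finite ?N"
    using finP by simp
  then have posN: "card ?N \<ge> 1"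
    using zero by (metis One_nat_def Suc_leI card_gt_0_iff empty_iff)
  have class_eq: "support_class Fs A = {x \<in> carrier P. supp Fs x = A}"
    using A by (auto simp: support_class_def nonzero_zero_divisors_eq)
  \<comment> \<open>This makes the natural-number difference \<open>order (Fs ! i) - 1\<close> agree
    with the integer one.\<close>
  have "order (Fs ! i) \<ge> 1" if "i \<in> A" for i
  proof -
    have "i < length Fs"
      using that sub by auto
    then show ?thesis
      using fin[of i] zero_closed_nth[of i] by (auto simp: order_def Suc_le_eq card_gt_0_iff)
  qed
  then have "int (card (support_class Fs A)) = (\<Prod>i\<in>A. int (order (Fs ! i)) - 1)"
    unfolding class_eq card_supp_eq[OF sub] by (simp add: of_nat_diff)
  then have cardW: "int (card ?W)
      = (if Suc (card A) = length Fs then \<Prod>i\<in>A. int (order (Fs ! i)) - 1 else 1)"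
    by simp
  have "card (?N - {\<zero>\<^bsub>P\<^esub>} \<union> ?W) = card (?N - {\<zero>\<^bsub>P\<^esub>}) + card ?W"
    by (rule card_Un_disjoint[OF fins NZ(3)])
  also have "\<dots> = card ?N - 1 + card ?W"
    by (simp only: card_Diff_singleton[OF zero])
  finally have cardNW: "int (card (?N - {\<zero>\<^bsub>P\<^esub>} \<union> ?W)) = int (card ?N) - 1 + int (card ?W)"
    using posN by (simp only: of_nat_add of_nat_diff of_nat_1)
  have NWZ: "?N - {\<zero>\<^bsub>P\<^esub>} \<union> ?W \<subseteq> ?Z"
    by (rule Un_least[OF NZ(1,2)])
  have "out_degree (with_proj (weak_zero_divisor_difference_graph P)) v
      = card (?Z - (?N - {\<zero>\<^bsub>P\<^esub>} \<union> ?W))"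
    unfolding out_degree_def out_arcs_difference_graph[OF v] N
    by (rule card_image) (simp add: inj_on_def)
  also have "\<dots> = card ?Z - card (?N - {\<zero>\<^bsub>P\<^esub>} \<union> ?W)"
    by (rule card_Diff_subset[OF finite_UnI[OF fins] NWZ])
  finally have "int (out_degree (with_proj (weak_zero_divisor_difference_graph P)) v)
      = int (card ?Z) - int (card (?N - {\<zero>\<^bsub>P\<^esub>} \<union> ?W))"
    using card_mono[OF finZ NWZ] by (simp only: of_nat_diff)
  moreover have "z - (a - 1 + b) = z - a - b + 1" for z a b :: int
    by simp
  ultimately show ?thesis
    unfolding cardNW cardN cardW by (rule trans)
qed

end

theorem proposition7p2:
  fixes Fs :: "('a, 'm) ring_scheme list"
    and R :: "'a list ring"
    and t :: nat
    and q :: "nat \<Rightarrow> nat"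
    and A :: "nat set"
    and v :: "'a list"
  assumes "t \<ge> 3"
    and "length Fs = t"
    and "\<And>i. i < t \<Longrightarrow> field (Fs ! i)"
    and "\<And>i. i < t \<Longrightarrow> finite (carrier (Fs ! i))"
    and "\<And>i. i < t \<Longrightarrow> order (Fs ! i) = q i"
    and "R = RDirProd_list Fs"
    and "A \<noteq> {}" and "A \<subset> {..<t}"
    and "v \<in> support_class Fs A"
  shows "(1 \<le> card A \<and> card A \<le> t - 2 \<longrightarrow>
            int (out_degree (with_proj (weak_zero_divisor_difference_graph R)) v)
              = int (card (nonzero_zero_divisors R)) - (\<Prod>i\<in>{..<t} - A. int (q i)))
       \<and> (card A = t - 1 \<longrightarrow>
            int (out_degree (with_proj (weak_zero_divisor_difference_graph R)) v)
              = int (card (nonzero_zero_divisors R)) - (\<Prod>i\<in>{..<t} - A. int (q i))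
                  - (\<Prod>i\<in>A. int (q i) - 1) + 1)"
proof -
  interpret field_list Fs
    by (rule field_list.intro) (simp add: assms(2,3))
  have A: "A \<subseteq> {..<length Fs}"
    using assms(2,8) by auto
  have "(\<Prod>i\<in>{..<length Fs} - A. int (order (Fs ! i))) = (\<Prod>i\<in>{..<t} - A. int (q i))"
    using assms(2,5) by (intro prod.cong) auto
  moreover have "(\<Prod>i\<in>A. int (order (Fs ! i)) - 1) = (\<Prod>i\<in>A. int (q i) - 1)"
    using assms(2,5) A by (intro prod.cong) auto
  \<comment> \<open>The bound on \<open>t\<close> keeps \<open>t - 1\<close> from being truncated.
    It also makes \<open>card A \<le> t - 2\<close> select the \<open>else\<close> branch.\<close>
  moreover have "Suc (card A) = length Fs \<longleftrightarrow> card A = t - 1"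
    using assms(1,2) by auto
  ultimately show ?thesis
    using out_degree_difference_graph[OF _ assms(9)] assms(1,2,4,6) by auto
qed

end
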